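(* Let $0\le t\le T_j<T_k\le\bar T$ and $\tilde T\in[T_j,T_k]$. Suppose that the dynamics of $F(t,\tilde T)$ and of $F(t,T_j,T_k)$ under $\mathbb Q$ are given respectively by $$dF(t,\tilde T)=K(\tilde T,t)\cdot dW^{\mathbb Q}_t,\qquad dF(t,T_j,T_k)=\bar K(t,T_j,T_k)\cdot dW^{\mathbb Q}_t,\qquad \bar K(t,T_j,T_k):=\frac1{T_k-T_j}\int_{T_j}^{T_k}K(T,t)\,dT,$$ and that the kernel $K(T,t)$ is H\"older continuous in $T\in[0,\bar T]$ with exponent $\rho\in(0,1]$, uniformly in $t\in[0,\bar T]$. Then $$\mathrm{Var}\big[F(t,\tilde T)-F(t,T_j,T_k)\big]=O\big((T_k-T_j)^{2\rho}\big),$$ i.e. there is a constant $M$, not depending on $t$, $\tilde T$, $T_j$, $T_k$, such that the left-hand side is at most $M(T_k-T_j)^{2\rho}$.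
   Context: $\bar T<\infty$ is a fixed horizon; $W^{\mathbb Q}$ is an $n$-dimensional Brownian motion under the probability measure $\mathbb Q$; $K:[0,\bar T]^2\to\mathbb R^n$ is a deterministic kernel vector with $\int_0^T|K(T,s)|^2ds<\infty$ for all $T\in[0,\bar T]$. $F(t,\tilde T)$ is the price at time $t$ of a forward with instantaneous delivery at $\tilde T$, and $F(t,T_j,T_k)=\frac1{T_k-T_j}\int_{T_j}^{T_k}F(t,T)\,dT$ is the price at time $t$ of a forward delivering over $[T_j,T_k]$. Initial values $F(0,\cdot)$ are deterministic, and the variance is taken under $\mathbb Q$. H\"older continuity uniformly in $t$ means: there is $C$ with $|K(T,s)-K(T',s)|\le C|T-T'|^\rho$ for all $T,T',s\in[0,\bar T]$. *)

theory Defs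
  imports "HOL-Probability.Probability"
begin

(* Standard Brownian motion in R^n on the time interval {0..S}, relative to a filtration G.
   The natural filtration of W is one admissible choice of G. The library's filtration locale
   is indexed by the whole type real; only its values on {0..S} are used. *)
definition brownian_motion ::
  "'w measure \<Rightarrow> (real \<Rightarrow> 'w measure) \<Rightarrow> real \<Rightarrow> (real \<Rightarrow> 'w \<Rightarrow> real ^ 'n) \<Rightarrow> bool" where
  "brownian_motion M G S W \<longleftrightarrow>
     prob_space M \<and>
     filtration (space M) G \<and>
     (\<forall>t\<in>{0..S}. subalgebra M (G t) \<and> W t \<in> borel_measurable (G t)) \<and>
     (AE \<omega> in M. W 0 \<omega> = 0) \<and>
     (AE \<omega> in M. continuous_on {0..S} (\<lambda>t. W t \<omega>)) \<and>
     (\<forall>s t. 0 \<le> s \<and> s < t \<and> t \<le> S \<longrightarrow>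
        prob_space.indep_set M (sets (G s))
          {(\<lambda>\<omega>. W t \<omega> - W s \<omega>) -` A \<inter> space M | A. A \<in> sets borel} \<and>
        prob_space.indep_vars M (\<lambda>_. borel) (\<lambda>i \<omega>. (W t \<omega> - W s \<omega>) $ i) UNIV \<and>
        (\<forall>i. distributed M lborel (\<lambda>\<omega>. (W t \<omega> - W s \<omega>) $ i)
               (normal_density 0 (sqrt (t - s)))))"

(* The data (m, \<tau>, \<xi>) encode the elementary process
   sum over i < m of \<xi> i times the indicator of the interval from \<tau> i (excluded)
   to \<tau> (i + 1) (included). *)
definition elementary_integrand ::
  "(real \<Rightarrow> 'w measure) \<Rightarrow> real \<Rightarrow> nat \<Rightarrow> (nat \<Rightarrow> real) \<Rightarrow> (nat \<Rightarrow> 'w \<Rightarrow> real ^ 'n) \<Rightarrow> bool" where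
  "elementary_integrand G t m \<tau> \<xi> \<longleftrightarrow>
     0 \<le> \<tau> 0 \<and> \<tau> m \<le> t \<and>
     (\<forall>i<m. \<tau> i < \<tau> (Suc i) \<and> \<xi> i \<in> borel_measurable (G (\<tau> i)) \<and>
            (\<exists>B. \<forall>\<omega>\<in>space (G (\<tau> i)). norm (\<xi> i \<omega>) \<le> B))"

definition elementary_process ::
  "nat \<Rightarrow> (nat \<Rightarrow> real) \<Rightarrow> (nat \<Rightarrow> 'w \<Rightarrow> real ^ 'n) \<Rightarrow> real \<Rightarrow> 'w \<Rightarrow> real ^ 'n" where
  "elementary_process m \<tau> \<xi> s \<omega> =
     (\<Sum>i<m. indicat_real {\<tau> i<..\<tau> (Suc i)} s *\<^sub>R \<xi> i \<omega>)"

definition elementary_integral ::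
  "(real \<Rightarrow> 'w \<Rightarrow> real ^ 'n) \<Rightarrow> nat \<Rightarrow> (nat \<Rightarrow> real) \<Rightarrow> (nat \<Rightarrow> 'w \<Rightarrow> real ^ 'n) \<Rightarrow> 'w \<Rightarrow> real" where
  "elementary_integral W m \<tau> \<xi> \<omega> = (\<Sum>i<m. \<xi> i \<omega> \<bullet> (W (\<tau> (Suc i)) \<omega> - W (\<tau> i) \<omega>))"

(* X is (a version of) the Ito integral of \<phi> \<bullet> dW over {0..t}: \<phi> is progressively
   measurable and is the limit, in L^2 of the product of dt and M, of elementary processes
   whose elementary stochastic integrals converge to X in L^2 of M. *)
definition has_ito_integral ::
  "'w measure \<Rightarrow> (real \<Rightarrow> 'w measure) \<Rightarrow> (real \<Rightarrow> 'w \<Rightarrow> real ^ 'n) \<Rightarrow> real \<Rightarrow>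
     (real \<Rightarrow> 'w \<Rightarrow> real ^ 'n) \<Rightarrow> ('w \<Rightarrow> real) \<Rightarrow> bool" where
  "has_ito_integral M G W t \<phi> X \<longleftrightarrow>
     (\<forall>u\<in>{0..t}. (\<lambda>(s, \<omega>). \<phi> s \<omega>) \<in> borel_measurable (restrict_space borel {0..u} \<Otimes>\<^sub>M G u)) \<and>
     X \<in> borel_measurable M \<and>
     (\<exists>m \<tau> \<xi>.
        (\<forall>k::nat. elementary_integrand G t (m k) (\<tau> k) (\<xi> k)) \<and>
        (\<lambda>k. \<integral>\<^sup>+\<omega>. (\<integral>\<^sup>+s\<in>{0..t}.
            ennreal ((norm (\<phi> s \<omega> - elementary_process (m k) (\<tau> k) (\<xi> k) s \<omega>))\<^sup>2) \<partial>lborel) \<partial>M)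
          \<longlonglongrightarrow> 0 \<and>
        (\<lambda>k. \<integral>\<^sup>+\<omega>. ennreal ((X \<omega> - elementary_integral W (m k) (\<tau> k) (\<xi> k) \<omega>)\<^sup>2) \<partial>M)
          \<longlonglongrightarrow> 0)"

(* dX(t) = \<phi>(t) \<bullet> dW(t) on {0..S}, in its integrated form. *)
definition has_dynamics ::
  "'w measure \<Rightarrow> (real \<Rightarrow> 'w measure) \<Rightarrow> (real \<Rightarrow> 'w \<Rightarrow> real ^ 'n) \<Rightarrow> real \<Rightarrow>
     (real \<Rightarrow> 'w \<Rightarrow> real) \<Rightarrow> (real \<Rightarrow> 'w \<Rightarrow> real ^ 'n) \<Rightarrow> bool" where
  "has_dynamics M G W S X \<phi> \<longleftrightarrow>
     (\<forall>t\<in>{0..S}. has_ito_integral M G W t \<phi> (\<lambda>\<omega>. X t \<omega> - X 0 \<omega>))"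

definition avg_forward ::
  "(real \<Rightarrow> real \<Rightarrow> 'w \<Rightarrow> real) \<Rightarrow> real \<Rightarrow> real \<Rightarrow> real \<Rightarrow> 'w \<Rightarrow> real" where
  "avg_forward F Tj Tk t \<omega> = 1 / (Tk - Tj) * (LBINT T:{Tj..Tk}. F t T \<omega>)"

definition avg_kernel ::
  "(real \<Rightarrow> real \<Rightarrow> real ^ 'n) \<Rightarrow> real \<Rightarrow> real \<Rightarrow> real \<Rightarrow> real ^ 'n" where
  "avg_kernel K Tj Tk t = (1 / (Tk - Tj)) *\<^sub>R (LBINT T:{Tj..Tk}. K T t)"

end

theory Submission
  imports Defs
begin

text \<open>
  Up to the deterministic initial values, the random variable whose variance is estimated is a
  difference of two Ito integrals. Expanding the square of a sum of terms
  \<open>\<xi> \<bullet> (W b - W a)\<close> bilinearly yields the Ito isometry for elementary integrands, where a mixed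
  term contributes the mean of \<open>\<xi> \<bullet> \<eta>\<close> times the length of the overlap of the two intervals; this
  needs no common refinement of the two partitions. Since only the order of magnitude matters, the
  passage to the limit uses the crude inequality
  \<open>\<bar>u + v + w\<bar>\<^sup>2 \<le> 3 (\<bar>u\<bar>\<^sup>2 + \<bar>v\<bar>\<^sup>2 + \<bar>w\<bar>\<^sup>2)\<close> twice and loses a factor \<open>9\<close>. The Hoelder
  condition bounds the difference of the two kernels by \<open>C (T\<^sub>k - T\<^sub>j)\<^sup>\<rho>\<close>, so
  \<open>M = 9 C\<^sup>2 Tbar\<close> works.
\<close>

section \<open>Three-term square inequalities and a product of inner products\<close>

text \<open>After the triangle inequality this is a statement about three reals: three times the sum
  of their squares exceeds the square of their sum by the sum of the squared pairwise
  differences.\<close>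

lemma norm_add3_square_le:
  fixes u v w :: "'a :: real_normed_vector"
  shows "(norm (u + v + w))\<^sup>2 \<le> 3 * ((norm u)\<^sup>2 + (norm v)\<^sup>2 + (norm w)\<^sup>2)"
proof -
  have "norm (u + v + w) \<le> norm u + norm v + norm w"
    by (intro norm_triangle_le add_mono order_refl norm_triangle_ineq)
  then have "(norm (u + v + w))\<^sup>2 \<le> (norm u + norm v + norm w)\<^sup>2"
    by (intro power_mono) auto
  also have "\<dots> \<le> 3 * ((norm u)\<^sup>2 + (norm v)\<^sup>2 + (norm w)\<^sup>2)"
    using zero_le_power2[of "norm u - norm v"] zero_le_power2[of "norm v - norm w"]
      zero_le_power2[of "norm u - norm w"]
    by (simp add: power2_eq_square algebra_simps)
  finally show ?thesis .
qed

text \<open>Serves twice in the passage to the limit: for real random variables on the probability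
  space, and for vector-valued integrands on its product with the time interval.\<close>

lemma nn_integral_norm_add3_square_le:
  fixes f g h :: "'a \<Rightarrow> 'b :: {second_countable_topology, real_normed_vector}"
  assumes [measurable]: "f \<in> borel_measurable N" "g \<in> borel_measurable N" "h \<in> borel_measurable N"
  shows "(\<integral>\<^sup>+x. ennreal ((norm (f x + g x + h x))\<^sup>2) \<partial>N)
    \<le> 3 * ((\<integral>\<^sup>+x. ennreal ((norm (f x))\<^sup>2) \<partial>N) + (\<integral>\<^sup>+x. ennreal ((norm (g x))\<^sup>2) \<partial>N)
        + (\<integral>\<^sup>+x. ennreal ((norm (h x))\<^sup>2) \<partial>N))"
proof -
  have "(\<integral>\<^sup>+x. ennreal ((norm (f x + g x + h x))\<^sup>2) \<partial>N)
      \<le> (\<integral>\<^sup>+x. 3 * (ennreal ((norm (f x))\<^sup>2) + ennreal ((norm (g x))\<^sup>2) + ennreal ((norm (h x))\<^sup>2)) \<partial>N)"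
  proof (rule nn_integral_mono)
    fix x
    have "ennreal ((norm (f x + g x + h x))\<^sup>2)
        \<le> ennreal (3 * ((norm (f x))\<^sup>2 + (norm (g x))\<^sup>2 + (norm (h x))\<^sup>2))"
      by (rule ennreal_leI[OF norm_add3_square_le])
    also have "\<dots> = 3 * (ennreal ((norm (f x))\<^sup>2) + ennreal ((norm (g x))\<^sup>2) + ennreal ((norm (h x))\<^sup>2))"
      by (simp add: ennreal_mult ennreal_plus distrib_left flip: ennreal_numeral)
    finally show "ennreal ((norm (f x + g x + h x))\<^sup>2)
        \<le> 3 * (ennreal ((norm (f x))\<^sup>2) + ennreal ((norm (g x))\<^sup>2) + ennreal ((norm (h x))\<^sup>2))" .
  qed
  then show ?thesis
    by (simp add: nn_integral_cmult nn_integral_add)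
qed

lemma borel_measurable_vec_nth [measurable (raw)]:
  fixes f :: "'a \<Rightarrow> real ^ 'n"
  assumes "f \<in> borel_measurable N" shows "(\<lambda>x. f x $ i) \<in> borel_measurable N"
  unfolding cart_eq_inner_axis using assms by measurable

text \<open>Separates the coefficients from the increments coordinate by coordinate, so that
  independence can be applied to each real-valued summand.\<close>

lemma inner_mult_inner:
  fixes x y u v :: "real ^ 'n"
  shows "(x \<bullet> u) * (y \<bullet> v) = (\<Sum>p\<in>UNIV. \<Sum>q\<in>UNIV. (x $ p * y $ q) * (u $ p * v $ q))"
  unfolding inner_vec_def sum_product by (simp add: mult_ac)

section \<open>Moments and independence of Brownian increments\<close>

locale brownian =
  fixes M :: "'w measure" and G :: "real \<Rightarrow> 'w measure" and S :: real
    and W :: "real \<Rightarrow> 'w \<Rightarrow> real ^ 'n"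
  assumes brownian: "brownian_motion M G S W"
begin

sublocale prob_space M
  using brownian by (simp add: brownian_motion_def)

lemma space_G [simp]: "space (G s) = space M"
  using brownian filtration.space_F unfolding brownian_motion_def by blast

lemma measurable_G_mono:
  assumes "f \<in> measurable (G s) N" "s \<le> t" shows "f \<in> measurable (G t) N"
proof -
  have "sets (G s) \<subseteq> sets (G t)"
    using brownian filtration.sets_F_mono assms(2) unfolding brownian_motion_def by blast
  with assms(1) show ?thesis by (auto simp: measurable_def)
qed

lemma sets_G: "0 \<le> s \<Longrightarrow> s \<le> S \<Longrightarrow> sets (G s) \<subseteq> sets M"
  using brownian by (auto simp: brownian_motion_def subalgebra_def)

lemma measurable_G_M:
  assumes "f \<in> measurable (G s) N" "0 \<le> s" "s \<le> S" shows "f \<in> measurable M N"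
  using assms(1) sets_G[OF assms(2,3)] by (auto simp: measurable_def)

lemma W_measurable_G: "0 \<le> s \<Longrightarrow> s \<le> t \<Longrightarrow> t \<le> S \<Longrightarrow> W s \<in> borel_measurable (G t)"
  using brownian by (intro measurable_G_mono[of "W s" s borel t]) (auto simp: brownian_motion_def)

lemma W_measurable: "0 \<le> s \<Longrightarrow> s \<le> S \<Longrightarrow> W s \<in> borel_measurable M"
  by (rule measurable_G_M[OF W_measurable_G[of s s]]) auto

context
  fixes s t :: real
  assumes st: "0 \<le> s" "s < t" "t \<le> S"
begin

lemma
  shows indep_set_increment:
      "indep_set (sets (G s)) {(\<lambda>\<omega>. W t \<omega> - W s \<omega>) -` A \<inter> space M | A. A \<in> sets borel}"
    and indep_vars_increment: "indep_vars (\<lambda>_. borel) (\<lambda>i \<omega>. (W t \<omega> - W s \<omega>) $ i) UNIV"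
    and increment_distributed:
      "distributed M lborel (\<lambda>\<omega>. (W t \<omega> - W s \<omega>) $ p) (normal_density 0 (sqrt (t - s)))"
  using brownian st unfolding brownian_motion_def by blast+

lemma increment_power_integrable: "integrable M (\<lambda>\<omega>. ((W t \<omega> - W s \<omega>) $ p) ^ k)"
  using integrable_normal_moment[of "sqrt (t - s)" 0 k] st
  by (subst distributed_integrable[OF increment_distributed, symmetric]) auto

lemma increment_integrable: "integrable M (\<lambda>\<omega>. (W t \<omega> - W s \<omega>) $ p)"
  using increment_power_integrable[of p 1] by simp

lemma increment_expectation: "expectation (\<lambda>\<omega>. (W t \<omega> - W s \<omega>) $ p) = 0"
  using normal_distributed_expectation[OF _ increment_distributed] st by simp

lemma increment_square_expectation: "expectation (\<lambda>\<omega>. ((W t \<omega> - W s \<omega>) $ p)\<^sup>2) = t - s"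
  using normal_distributed_variance[OF _ increment_distributed, of p] st increment_expectation[of p]
  by simp

text \<open>On the diagonal this is the variance of a coordinate. Off the diagonal, independence of
  the coordinates factors the mean into a product of two means, both zero.\<close>

lemma increment_covariance:
  "has_bochner_integral M (\<lambda>\<omega>. (W t \<omega> - W s \<omega>) $ p * (W t \<omega> - W s \<omega>) $ q)
     (if p = q then t - s else 0)"
proof (cases "p = q")
  case True
  then show ?thesis
    using increment_power_integrable[of p 2] increment_square_expectation[of p]
    by (simp add: has_bochner_integral_iff power2_eq_square)
next
  case False
  have indep: "indep_vars (\<lambda>_. borel) (\<lambda>i \<omega>. (W t \<omega> - W s \<omega>) $ i) {p, q}"
    using indep_vars_increment by (rule indep_vars_subset) simp
  \<comment> \<open>The product is taken over the index set \<open>{p, q}\<close>, the form in which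
    independence of a family factors an expectation; it has two factors because \<open>p\<close> and
    \<open>q\<close> differ.\<close>
  have "integrable M (\<lambda>\<omega>. \<Prod>i\<in>{p, q}. (W t \<omega> - W s \<omega>) $ i)"
    and "expectation (\<lambda>\<omega>. \<Prod>i\<in>{p, q}. (W t \<omega> - W s \<omega>) $ i)
      = (\<Prod>i\<in>{p, q}. expectation (\<lambda>\<omega>. (W t \<omega> - W s \<omega>) $ i))"
    using indep increment_integrable
    by (auto intro!: indep_vars_integrable indep_vars_lebesgue_integral simp del: vector_minus_component)
  with False show ?thesis
    by (simp add: has_bochner_integral_iff increment_expectation del: vector_minus_component)
qed

text \<open>Independence passes to smaller families: the sigma-algebra generated by \<open>U\<close>
  lies in \<open>G s\<close>, and the one generated by \<open>f\<close> of the increment lies among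
  the preimages under the increment itself.\<close>

lemma increment_indep:
  fixes U :: "'w \<Rightarrow> real" and f :: "real ^ 'n \<Rightarrow> real"
  assumes U: "U \<in> borel_measurable (G s)" and f: "f \<in> borel_measurable borel"
  shows "indep_var borel U borel (\<lambda>\<omega>. f (W t \<omega> - W s \<omega>))"
proof -
  have gen_U: "sigma_sets (space M) {U -` A \<inter> space M |A. A \<in> sets borel} \<subseteq> sets (G s)"
    using measurable_sets[OF U] sets.sigma_sets_subset[of "{U -` A \<inter> space M |A. A \<in> sets borel}" "G s"]
    by auto
  have gen_f: "sigma_sets (space M) {(\<lambda>\<omega>. f (W t \<omega> - W s \<omega>)) -` A \<inter> space M |A. A \<in> sets borel}
      \<subseteq> {(\<lambda>\<omega>. W t \<omega> - W s \<omega>) -` A \<inter> space M | A. A \<in> sets borel}"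
  proof -
    \<comment> \<open>The preimages of Borel sets under the increment already form a sigma-algebra,
      the \<open>vimage_algebra\<close>, so it is enough to place the generators in it.\<close>
    have "{(\<lambda>\<omega>. f (W t \<omega> - W s \<omega>)) -` A \<inter> space M |A. A \<in> sets borel}
        \<subseteq> sets (vimage_algebra (space M) (\<lambda>\<omega>. W t \<omega> - W s \<omega>) borel)"
    proof safe
      fix A :: "real set" assume "A \<in> sets borel"
      with f have "f -` A \<in> sets borel"
        using measurable_sets[of f borel borel A] by simp
      then have "(\<lambda>\<omega>. W t \<omega> - W s \<omega>) -` (f -` A) \<inter> space M
          \<in> sets (vimage_algebra (space M) (\<lambda>\<omega>. W t \<omega> - W s \<omega>) borel)"
        by (rule in_vimage_algebra)
      then show "(\<lambda>\<omega>. f (W t \<omega> - W s \<omega>)) -` A \<inter> space M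
          \<in> sets (vimage_algebra (space M) (\<lambda>\<omega>. W t \<omega> - W s \<omega>) borel)"
        by (simp add: vimage_def)
    qed
    from sets.sigma_sets_subset[OF this] show ?thesis
      using sets_vimage_algebra2[of "\<lambda>\<omega>. W t \<omega> - W s \<omega>" "space M" borel] by simp
  qed
  have "U \<in> borel_measurable M"
    using measurable_G_M[OF U] st by simp
  moreover have "(\<lambda>\<omega>. f (W t \<omega> - W s \<omega>)) \<in> borel_measurable M"
    using st by (intro measurable_compose[OF _ f] borel_measurable_diff W_measurable) auto
  moreover have "indep_set (sigma_sets (space M) {U -` A \<inter> space M |A. A \<in> sets borel})
      (sigma_sets (space M) {(\<lambda>\<omega>. f (W t \<omega> - W s \<omega>)) -` A \<inter> space M |A. A \<in> sets borel})"
    unfolding indep_set_def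
  proof (rule indep_sets_mono_sets[OF indep_set_increment[unfolded indep_set_def]])
    fix i
    show "case_bool (sigma_sets (space M) {U -` A \<inter> space M |A. A \<in> sets borel})
        (sigma_sets (space M) {(\<lambda>\<omega>. f (W t \<omega> - W s \<omega>)) -` A \<inter> space M |A. A \<in> sets borel}) i
      \<subseteq> case_bool (sets (G s)) {(\<lambda>\<omega>. W t \<omega> - W s \<omega>) -` A \<inter> space M |A. A \<in> sets borel} i"
      by (cases i) (simp_all only: bool.case gen_U gen_f)
  qed
  ultimately show ?thesis
    unfolding indep_var_eq by (intro conjI)
qed

text \<open>The function \<open>f\<close> will be a single coordinate for disjoint intervals, which
  makes \<open>c\<close> zero, and a product of two coordinates for equal intervals, which makes
  \<open>c\<close> a covariance.\<close>

lemma has_bochner_integral_mult_increment: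
  fixes U :: "'w \<Rightarrow> real" and f :: "real ^ 'n \<Rightarrow> real"
  assumes U: "U \<in> borel_measurable (G s)" "integrable M U"
    and f: "f \<in> borel_measurable borel" "has_bochner_integral M (\<lambda>\<omega>. f (W t \<omega> - W s \<omega>)) c"
  shows "has_bochner_integral M (\<lambda>\<omega>. U \<omega> * f (W t \<omega> - W s \<omega>)) (expectation U * c)"
  using indep_var_lebesgue_integral[OF increment_indep[OF U(1) f(1)] U(2)]
    indep_var_integrable[OF increment_indep[OF U(1) f(1)] U(2)] f(2)
  by (simp add: has_bochner_integral_iff)

end

section \<open>Bounded coefficients known at a given time\<close>

text \<open>The condition that \<open>elementary_integrand\<close> puts on one coefficient. Unlike
  the whole grid, it can be carried to a later time, which is what cutting an interval into pieces
  requires.\<close>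

definition bounded_at :: "real \<Rightarrow> ('w \<Rightarrow> real ^ 'n) \<Rightarrow> bool" where
  "bounded_at s \<xi> \<longleftrightarrow> \<xi> \<in> borel_measurable (G s) \<and> (\<exists>B. \<forall>\<omega>\<in>space M. norm (\<xi> \<omega>) \<le> B)"

lemma bounded_at_mono: "bounded_at s \<xi> \<Longrightarrow> s \<le> t \<Longrightarrow> bounded_at t \<xi>"
  unfolding bounded_at_def using measurable_G_mono by blast

lemma bounded_at_measurable: "bounded_at s \<xi> \<Longrightarrow> 0 \<le> s \<Longrightarrow> s \<le> S \<Longrightarrow> \<xi> \<in> borel_measurable M"
  unfolding bounded_at_def using measurable_G_M by blast

lemma bounded_at_minus: "bounded_at s \<xi> \<Longrightarrow> bounded_at s (\<lambda>\<omega>. - \<xi> \<omega>)"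
  unfolding bounded_at_def by auto

lemma bounded_at_mult:
  assumes "bounded_at s \<xi>" "bounded_at s \<eta>"
  obtains B where "\<And>\<omega>. \<omega> \<in> space M \<Longrightarrow> \<bar>\<xi> \<omega> $ p * \<eta> \<omega> $ q\<bar> \<le> B"
proof -
  obtain B where B: "\<And>\<omega>. \<omega> \<in> space M \<Longrightarrow> norm (\<xi> \<omega>) \<le> B"
    using assms(1) by (auto simp: bounded_at_def)
  obtain C where C: "\<And>\<omega>. \<omega> \<in> space M \<Longrightarrow> norm (\<eta> \<omega>) \<le> C"
    using assms(2) by (auto simp: bounded_at_def)
  have "\<bar>\<xi> \<omega> $ p * \<eta> \<omega> $ q\<bar> \<le> B * C" if "\<omega> \<in> space M" for \<omega>
    unfolding abs_mult
    using B[OF that] C[OF that] component_le_norm_cart[of "\<xi> \<omega>" p] component_le_norm_cart[of "\<eta> \<omega>" q]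
    by (intro mult_mono) auto
  then show thesis using that by blast
qed

lemma bounded_at_measurable_mult:
  assumes "bounded_at s \<xi>" "bounded_at s \<eta>"
  shows "(\<lambda>\<omega>. \<xi> \<omega> $ p * \<eta> \<omega> $ q) \<in> borel_measurable (G s)"
proof -
  have [measurable]: "\<xi> \<in> borel_measurable (G s)" "\<eta> \<in> borel_measurable (G s)"
    using assms by (auto simp: bounded_at_def)
  show ?thesis by measurable
qed

lemma bounded_at_integrable_mult:
  assumes "bounded_at s \<xi>" "bounded_at s \<eta>" "0 \<le> s" "s \<le> S"
  shows "integrable M (\<lambda>\<omega>. \<xi> \<omega> $ p * \<eta> \<omega> $ q)"
proof -
  obtain B where "\<And>\<omega>. \<omega> \<in> space M \<Longrightarrow> \<bar>\<xi> \<omega> $ p * \<eta> \<omega> $ q\<bar> \<le> B"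
    using bounded_at_mult[OF assms(1,2)] by blast
  then show ?thesis
    using measurable_G_M[OF bounded_at_measurable_mult[OF assms(1,2)]] assms(3,4)
    by (intro integrable_const_bound[of _ B]) auto
qed

lemma bounded_at_integrable_inner:
  assumes "bounded_at s \<xi>" "bounded_at s \<eta>" "0 \<le> s" "s \<le> S"
  shows "integrable M (\<lambda>\<omega>. \<xi> \<omega> \<bullet> \<eta> \<omega>)"
  unfolding inner_vec_def by (auto intro!: Bochner_Integration.integrable_sum bounded_at_integrable_mult[OF assms])

section \<open>Ito isometry for elementary integrands\<close>

text \<open>The coefficients are known at time \<open>a\<close>, so they factor out of the mean, and
  the covariance matrix of the increment is \<open>b - a\<close> times the identity: the double sum
  over coordinates collapses to the inner product.\<close>

lemma ito_isometry_same:
  assumes "bounded_at a \<xi>" "bounded_at a \<eta>" "0 \<le> a" "a \<le> b" "b \<le> S"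
  shows "has_bochner_integral M (\<lambda>\<omega>. (\<xi> \<omega> \<bullet> (W b \<omega> - W a \<omega>)) * (\<eta> \<omega> \<bullet> (W b \<omega> - W a \<omega>)))
           (expectation (\<lambda>\<omega>. \<xi> \<omega> \<bullet> \<eta> \<omega>) * (b - a))"
proof (cases "a = b")
  case True
  then show ?thesis by (simp add: has_bochner_integral_zero)
next
  case False
  with assms have ab: "a < b" by simp
  have int: "integrable M (\<lambda>\<omega>. \<xi> \<omega> $ p * \<eta> \<omega> $ q)" for p q
    using assms by (intro bounded_at_integrable_mult[of a]) auto
  have "has_bochner_integral M (\<lambda>\<omega>. \<Sum>p\<in>UNIV. \<Sum>q\<in>UNIV.
          (\<xi> \<omega> $ p * \<eta> \<omega> $ q) * ((W b \<omega> - W a \<omega>) $ p * (W b \<omega> - W a \<omega>) $ q))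
        (\<Sum>p\<in>UNIV. \<Sum>q\<in>UNIV. expectation (\<lambda>\<omega>. \<xi> \<omega> $ p * \<eta> \<omega> $ q) * (if p = q then b - a else 0))"
    by (intro has_bochner_integral_sum
          has_bochner_integral_mult_increment[OF assms(3) ab assms(5), where f = "\<lambda>x. x $ p * x $ q" for p q]
          bounded_at_measurable_mult[OF assms(1,2)] int increment_covariance[OF assms(3) ab assms(5)])
       measurable
  also have "(\<lambda>\<omega>. \<Sum>p\<in>UNIV. \<Sum>q\<in>UNIV.
          (\<xi> \<omega> $ p * \<eta> \<omega> $ q) * ((W b \<omega> - W a \<omega>) $ p * (W b \<omega> - W a \<omega>) $ q))
        = (\<lambda>\<omega>. (\<xi> \<omega> \<bullet> (W b \<omega> - W a \<omega>)) * (\<eta> \<omega> \<bullet> (W b \<omega> - W a \<omega>)))"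
    by (simp only: inner_mult_inner)
  also have "(\<Sum>p\<in>UNIV. \<Sum>q\<in>UNIV. expectation (\<lambda>\<omega>. \<xi> \<omega> $ p * \<eta> \<omega> $ q) * (if p = q then b - a else 0))
        = expectation (\<lambda>\<omega>. \<xi> \<omega> \<bullet> \<eta> \<omega>) * (b - a)"
    by (simp add: inner_vec_def Bochner_Integration.integral_sum[OF int] sum_distrib_right if_distrib cong: if_cong)
  finally show ?thesis .
qed

lemma ito_isometry_disjoint:
  assumes "bounded_at a \<xi>" "bounded_at c \<eta>" "0 \<le> a" "a \<le> b" "b \<le> c" "c \<le> d" "d \<le> S"
  shows "has_bochner_integral M (\<lambda>\<omega>. (\<xi> \<omega> \<bullet> (W b \<omega> - W a \<omega>)) * (\<eta> \<omega> \<bullet> (W d \<omega> - W c \<omega>))) 0"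
proof (cases "a = b \<or> c = d")
  case True
  then show ?thesis by (auto simp: has_bochner_integral_zero)
next
  case False
  with assms have ab: "a < b" "b \<le> S" and cd: "0 \<le> c" "c < d" by auto
  have bc: "bounded_at c \<xi>" using bounded_at_mono[OF assms(1)] assms by simp
  \<comment> \<open>\<open>U p q\<close> gathers every factor known at time \<open>c\<close>;
    coordinate \<open>q\<close> of the later increment stays outside.\<close>
  define U where "U p q \<omega> = (\<xi> \<omega> $ p * \<eta> \<omega> $ q) * (W b \<omega> - W a \<omega>) $ p" for p q \<omega>
  have U: "U p q \<in> borel_measurable (G c)" for p q
  proof -
    have [measurable]: "W a \<in> borel_measurable (G c)" "W b \<in> borel_measurable (G c)"
        "(\<lambda>\<omega>. \<xi> \<omega> $ p * \<eta> \<omega> $ q) \<in> borel_measurable (G c)"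
      using W_measurable_G assms bounded_at_measurable_mult[OF bc assms(2)] by auto
    show ?thesis unfolding U_def by measurable
  qed
  have Ui: "integrable M (U p q)" for p q
  proof -
    obtain B where B: "\<And>\<omega>. \<omega> \<in> space M \<Longrightarrow> \<bar>\<xi> \<omega> $ p * \<eta> \<omega> $ q\<bar> \<le> B"
      using bounded_at_mult[OF bc assms(2)] by blast
    \<comment> \<open>The earlier increment is not bounded, but the coefficients are, so
      \<open>U p q\<close> is dominated by a constant multiple of an integrable variable.\<close>
    show ?thesis
    proof (rule Bochner_Integration.integrable_bound)
      show "integrable M (\<lambda>\<omega>. B * (W b \<omega> - W a \<omega>) $ p)"
        using increment_integrable[OF assms(3) ab] by simp
      show "U p q \<in> borel_measurable M"
        using measurable_G_M[OF U] cd assms by simp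
      show "AE \<omega> in M. norm (U p q \<omega>) \<le> norm (B * (W b \<omega> - W a \<omega>) $ p)"
      proof (rule AE_I2)
        fix \<omega> assume "\<omega> \<in> space M"
        from B[OF this] show "norm (U p q \<omega>) \<le> norm (B * (W b \<omega> - W a \<omega>) $ p)"
          unfolding U_def real_norm_def abs_mult[of _ "(W b \<omega> - W a \<omega>) $ p"]
          by (intro mult_right_mono) auto
      qed
    qed
  qed
  have inc: "has_bochner_integral M (\<lambda>\<omega>. (W d \<omega> - W c \<omega>) $ q) 0" for q
    using increment_integrable increment_expectation cd assms by (simp add: has_bochner_integral_iff)
  have "has_bochner_integral M (\<lambda>\<omega>. \<Sum>p\<in>UNIV. \<Sum>q\<in>UNIV. U p q \<omega> * (W d \<omega> - W c \<omega>) $ q)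
        (\<Sum>p\<in>UNIV. \<Sum>q\<in>UNIV. expectation (U p q) * 0)"
    by (intro has_bochner_integral_sum
          has_bochner_integral_mult_increment[OF cd assms(7), where f = "\<lambda>x. x $ q" for q] U Ui inc)
       measurable
  also have "(\<lambda>\<omega>. \<Sum>p\<in>UNIV. \<Sum>q\<in>UNIV. U p q \<omega> * (W d \<omega> - W c \<omega>) $ q)
        = (\<lambda>\<omega>. (\<xi> \<omega> \<bullet> (W b \<omega> - W a \<omega>)) * (\<eta> \<omega> \<bullet> (W d \<omega> - W c \<omega>)))"
    by (simp only: U_def inner_mult_inner mult.assoc)
  finally show ?thesis by simp
qed

text \<open>Cutting both intervals at the ends of their overlap leaves products of increments over
  intervals that either coincide or are disjoint. The coinciding pair contributes the length of the
  overlap, the others nothing.\<close>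

lemma ito_isometry_pair:
  assumes \<xi>: "bounded_at a \<xi>" "0 \<le> a" "a < b" "b \<le> S"
    and \<eta>: "bounded_at c \<eta>" "0 \<le> c" "c < d" "d \<le> S"
  shows "has_bochner_integral M (\<lambda>\<omega>. (\<xi> \<omega> \<bullet> (W b \<omega> - W a \<omega>)) * (\<eta> \<omega> \<bullet> (W d \<omega> - W c \<omega>)))
           (expectation (\<lambda>\<omega>. \<xi> \<omega> \<bullet> \<eta> \<omega>) * measure lborel ({a<..b} \<inter> {c<..d}))"
proof -
  \<comment> \<open>Everything is generalised here so that the case \<open>c < a\<close> follows by
    exchanging the two factors.\<close>
  have le: "has_bochner_integral M (\<lambda>\<omega>. (\<xi> \<omega> \<bullet> (W b \<omega> - W a \<omega>)) * (\<eta> \<omega> \<bullet> (W d \<omega> - W c \<omega>)))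
           (expectation (\<lambda>\<omega>. \<xi> \<omega> \<bullet> \<eta> \<omega>) * measure lborel ({a<..b} \<inter> {c<..d}))"
    if \<xi>: "bounded_at a \<xi>" "0 \<le> a" "a < b" "b \<le> S"
      and \<eta>: "bounded_at c \<eta>" "0 \<le> c" "c < d" "d \<le> S" and ac: "a \<le> c"
    for a b c d \<xi> \<eta>
  proof -
    have bc: "bounded_at c \<xi>" using bounded_at_mono[OF \<xi>(1) ac] .
    consider "b \<le> c" | "c < b" "b \<le> d" | "c < b" "d < b" by linarith
    then show ?thesis
    proof cases
      case 1
      then have [simp]: "{a<..b} \<inter> {c<..d} = {}" by auto
      show ?thesis using ito_isometry_disjoint[OF \<xi>(1) \<eta>(1)] 1 \<xi> \<eta> by simp
    next
      case 2
      then have len: "measure lborel ({a<..b} \<inter> {c<..d}) = b - c" using ac by (simp add: max_absorb2 min_absorb1)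
      \<comment> \<open>The overlap runs from \<open>c\<close> to \<open>b\<close>: the first
        increment is cut at \<open>c\<close>, and in the part after \<open>c\<close> the second one
        is cut at \<open>b\<close>. In the last product \<open>\<xi>\<close> is regarded as known at
        \<open>c\<close> and \<open>\<eta>\<close> at \<open>b\<close>.\<close>
      have "has_bochner_integral M (\<lambda>\<omega>.
          (\<xi> \<omega> \<bullet> (W c \<omega> - W a \<omega>)) * (\<eta> \<omega> \<bullet> (W d \<omega> - W c \<omega>))
          + (\<xi> \<omega> \<bullet> (W b \<omega> - W c \<omega>)) * (\<eta> \<omega> \<bullet> (W b \<omega> - W c \<omega>))
          + (\<xi> \<omega> \<bullet> (W b \<omega> - W c \<omega>)) * (\<eta> \<omega> \<bullet> (W d \<omega> - W b \<omega>)))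
         (0 + expectation (\<lambda>\<omega>. \<xi> \<omega> \<bullet> \<eta> \<omega>) * (b - c) + 0)"
        using 2 \<xi> \<eta> ac bc bounded_at_mono[OF \<eta>(1), of b]
        by (intro has_bochner_integral_add ito_isometry_same ito_isometry_disjoint) auto
      then show ?thesis unfolding len by (simp only: inner_diff_right) (simp add: algebra_simps)
    next
      case 3
      then have len: "measure lborel ({a<..b} \<inter> {c<..d}) = d - c" using ac \<eta> by (simp add: max_absorb2 min_absorb2)
      \<comment> \<open>The second interval lies inside the first, which is cut at \<open>c\<close>
        and at \<open>d\<close>. The factors of the last product are exchanged because the disjoint
        case wants the earlier interval first; there \<open>\<xi>\<close> is regarded as known at
        \<open>d\<close>.\<close>
      have "has_bochner_integral M (\<lambda>\<omega>.
          (\<xi> \<omega> \<bullet> (W c \<omega> - W a \<omega>)) * (\<eta> \<omega> \<bullet> (W d \<omega> - W c \<omega>))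
          + (\<xi> \<omega> \<bullet> (W d \<omega> - W c \<omega>)) * (\<eta> \<omega> \<bullet> (W d \<omega> - W c \<omega>))
          + (\<eta> \<omega> \<bullet> (W d \<omega> - W c \<omega>)) * (\<xi> \<omega> \<bullet> (W b \<omega> - W d \<omega>)))
         (0 + expectation (\<lambda>\<omega>. \<xi> \<omega> \<bullet> \<eta> \<omega>) * (d - c) + 0)"
        using 3 \<xi> \<eta> ac bc bounded_at_mono[OF bc, of d]
        by (intro has_bochner_integral_add ito_isometry_same ito_isometry_disjoint) auto
      then show ?thesis unfolding len by (simp only: inner_diff_right) (simp add: algebra_simps)
    qed
  qed
  show ?thesis
  proof (cases "a \<le> c")
    case True
    then show ?thesis using le[OF \<xi> \<eta>] by simp
  next
    case False
    then show ?thesis using le[OF \<eta> \<xi>] by (simp add: mult.commute inner_commute Int_commute)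
  qed
qed

text \<open>Both sides equal the double sum \<open>V\<close> of means of inner products times
  overlap lengths. The intervals may overlap freely, so the intervals of two integrands can be put
  into one family.\<close>

lemma ito_isometry_sum:
  fixes a b :: "'i \<Rightarrow> real" and \<xi> :: "'i \<Rightarrow> 'w \<Rightarrow> real ^ 'n"
  assumes J: "finite J" "\<And>i. i \<in> J \<Longrightarrow> bounded_at (a i) (\<xi> i)"
      "\<And>i. i \<in> J \<Longrightarrow> 0 \<le> a i" "\<And>i. i \<in> J \<Longrightarrow> a i < b i" "\<And>i. i \<in> J \<Longrightarrow> b i \<le> t"
    and t: "0 \<le> t" "t \<le> S"
  shows "(\<integral>\<^sup>+\<omega>. ennreal ((\<Sum>i\<in>J. \<xi> i \<omega> \<bullet> (W (b i) \<omega> - W (a i) \<omega>))\<^sup>2) \<partial>M)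
    = (\<integral>\<^sup>+\<omega>. (\<integral>\<^sup>+s\<in>{0..t}. ennreal ((norm (\<Sum>i\<in>J. indicat_real {a i<..b i} s *\<^sub>R \<xi> i \<omega>))\<^sup>2) \<partial>lborel) \<partial>M)"
    (is "?lhs = ?rhs")
proof -
  define m where "m i j = measure lborel ({a i<..b i} \<inter> {a j<..b j})" for i j
  have fin: "emeasure lborel ({a i<..b i} \<inter> {a j<..b j}) < \<infinity>" for i j
    by (intro emeasure_bounded_finite bounded_Int) simp
  define V where "V = (\<Sum>i\<in>J. \<Sum>j\<in>J. expectation (\<lambda>\<omega>. \<xi> i \<omega> \<bullet> \<xi> j \<omega>) * m i j)"
  have "has_bochner_integral M
      (\<lambda>\<omega>. \<Sum>i\<in>J. \<Sum>j\<in>J. (\<xi> i \<omega> \<bullet> (W (b i) \<omega> - W (a i) \<omega>)) * (\<xi> j \<omega> \<bullet> (W (b j) \<omega> - W (a j) \<omega>))) V"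
    unfolding V_def m_def using J t
    by (intro has_bochner_integral_sum ito_isometry_pair) (auto intro: order_trans[OF _ t(2)])
  then have L: "has_bochner_integral M (\<lambda>\<omega>. (\<Sum>i\<in>J. \<xi> i \<omega> \<bullet> (W (b i) \<omega> - W (a i) \<omega>))\<^sup>2) V"
    by (simp only: power2_eq_square sum_product)
  have lhs: "?lhs = ennreal V"
    using L by (subst nn_integral_eq_integral) (auto simp: has_bochner_integral_iff)
  have int: "integrable M (\<lambda>\<omega>. \<xi> i \<omega> \<bullet> \<xi> j \<omega>)" if "i \<in> J" "j \<in> J" for i j
  proof -
    \<comment> \<open>Two coefficients belong to different times; regarding both as known at
      \<open>t\<close> puts them on the same footing.\<close>
    have "bounded_at t (\<xi> k)" if "k \<in> J" for k
      using bounded_at_mono[OF J(2)[OF that], of t] J(4,5)[OF that] by simp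
    then show ?thesis
      using that t by (intro bounded_at_integrable_inner[of t])
  qed
  have R: "has_bochner_integral M (\<lambda>\<omega>. \<Sum>i\<in>J. \<Sum>j\<in>J. (\<xi> i \<omega> \<bullet> \<xi> j \<omega>) * m i j) V"
    unfolding V_def using int
    by (intro has_bochner_integral_sum has_bochner_integral_mult_left) (auto simp: has_bochner_integral_iff)
  have inner: "has_bochner_integral lborel (\<lambda>s. (norm (\<Sum>i\<in>J. indicat_real {a i<..b i} s *\<^sub>R \<xi> i \<omega>))\<^sup>2)
      (\<Sum>i\<in>J. \<Sum>j\<in>J. (\<xi> i \<omega> \<bullet> \<xi> j \<omega>) * m i j)" for \<omega>
  proof -
    have "has_bochner_integral lborel
        (\<lambda>s. \<Sum>i\<in>J. \<Sum>j\<in>J. (\<xi> i \<omega> \<bullet> \<xi> j \<omega>) * indicat_real ({a i<..b i} \<inter> {a j<..b j}) s)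
        (\<Sum>i\<in>J. \<Sum>j\<in>J. (\<xi> i \<omega> \<bullet> \<xi> j \<omega>) * m i j)"
      unfolding m_def
      by (intro has_bochner_integral_sum has_bochner_integral_mult_right has_bochner_integral_real_indicator fin) simp
    also have "(\<lambda>s. \<Sum>i\<in>J. \<Sum>j\<in>J. (\<xi> i \<omega> \<bullet> \<xi> j \<omega>) * indicat_real ({a i<..b i} \<inter> {a j<..b j}) s)
        = (\<lambda>s. (norm (\<Sum>i\<in>J. indicat_real {a i<..b i} s *\<^sub>R \<xi> i \<omega>))\<^sup>2)"
      unfolding power2_norm_eq_inner inner_sum_left inner_sum_right indicator_inter_arith
      by (simp add: mult_ac inner_commute)
    finally show ?thesis .
  qed
  have "(\<integral>\<^sup>+s\<in>{0..t}. ennreal ((norm (\<Sum>i\<in>J. indicat_real {a i<..b i} s *\<^sub>R \<xi> i \<omega>))\<^sup>2) \<partial>lborel)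
      = ennreal (\<Sum>i\<in>J. \<Sum>j\<in>J. (\<xi> i \<omega> \<bullet> \<xi> j \<omega>) * m i j)" for \<omega>
  proof -
    \<comment> \<open>All intervals lie within \<open>{0..t}\<close>, so restricting the time
      integral to that set changes nothing.\<close>
    have "(\<Sum>i\<in>J. indicat_real {a i<..b i} s *\<^sub>R \<xi> i \<omega>) = 0" if "s \<notin> {0..t}" for s
      using that J(3,5) by (intro sum.neutral) (fastforce simp: indicator_def)
    then have "(\<integral>\<^sup>+s\<in>{0..t}. ennreal ((norm (\<Sum>i\<in>J. indicat_real {a i<..b i} s *\<^sub>R \<xi> i \<omega>))\<^sup>2) \<partial>lborel)
      = (\<integral>\<^sup>+s. ennreal ((norm (\<Sum>i\<in>J. indicat_real {a i<..b i} s *\<^sub>R \<xi> i \<omega>))\<^sup>2) \<partial>lborel)"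
      by (intro nn_integral_cong) (auto simp: indicator_def)
    also have "\<dots> = ennreal (\<Sum>i\<in>J. \<Sum>j\<in>J. (\<xi> i \<omega> \<bullet> \<xi> j \<omega>) * m i j)"
      using inner[of \<omega>] by (subst nn_integral_eq_integral) (auto simp: has_bochner_integral_iff)
    finally show ?thesis .
  qed
  moreover have "(\<integral>\<^sup>+\<omega>. ennreal (\<Sum>i\<in>J. \<Sum>j\<in>J. (\<xi> i \<omega> \<bullet> \<xi> j \<omega>) * m i j) \<partial>M) = ennreal V"
  proof (subst nn_integral_eq_integral)
    show "AE \<omega> in M. 0 \<le> (\<Sum>i\<in>J. \<Sum>j\<in>J. (\<xi> i \<omega> \<bullet> \<xi> j \<omega>) * m i j)"
    proof (rule AE_I2)
      fix \<omega>
      \<comment> \<open>The sign of this quadratic form is not visible term by term; it comes from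
        the form being the integral of a squared norm.\<close>
      have "0 \<le> (LINT s|lborel. (norm (\<Sum>i\<in>J. indicat_real {a i<..b i} s *\<^sub>R \<xi> i \<omega>))\<^sup>2)"
        by simp
      then show "0 \<le> (\<Sum>i\<in>J. \<Sum>j\<in>J. (\<xi> i \<omega> \<bullet> \<xi> j \<omega>) * m i j)"
        using has_bochner_integral_integral_eq[OF inner] by simp
    qed
  qed (use R in \<open>auto simp: has_bochner_integral_iff\<close>)
  ultimately show ?thesis
    unfolding lhs by simp
qed

text \<open>The grid increases, so bounds at its two ends reach every interval: by induction upwards
  from \<open>0\<close> for the left end and downwards from \<open>m\<close> for the right
  end.\<close>

lemma elementary_integrandD:
  fixes \<xi> :: "nat \<Rightarrow> 'w \<Rightarrow> real ^ 'n"
  assumes "elementary_integrand G t m \<tau> \<xi>" "i < m"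
  shows "bounded_at (\<tau> i) (\<xi> i)" "0 \<le> \<tau> i" "\<tau> i < \<tau> (Suc i)" "\<tau> (Suc i) \<le> t"
proof -
  have step: "\<tau> j < \<tau> (Suc j)" if "j < m" for j
    using assms(1) that by (simp add: elementary_integrand_def)
  have "\<tau> 0 \<le> \<tau> j" if "j \<le> m" for j
    using that
  proof (induction j)
    case (Suc j)
    then show ?case using step[of j] by simp
  qed simp
  from this[of i] assms show "0 \<le> \<tau> i"
    by (simp add: elementary_integrand_def)
  have "\<tau> (Suc i) \<le> \<tau> m"
  proof -
    have "Suc i \<le> m" using assms(2) by simp
    then show ?thesis
    proof (induction rule: inc_induct)
      case (step n)
      then show ?case using \<open>\<And>j. j < m \<Longrightarrow> \<tau> j < \<tau> (Suc j)\<close>[of n] by simp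
    qed simp
  qed
  with assms(1) show "\<tau> (Suc i) \<le> t"
    by (simp add: elementary_integrand_def)
  show "bounded_at (\<tau> i) (\<xi> i)" "\<tau> i < \<tau> (Suc i)"
    using assms by (auto simp: elementary_integrand_def bounded_at_def)
qed

text \<open>The difference is itself a sum over the disjoint union of the two index sets, with the
  sign moved into the coefficients of the second integrand.\<close>

lemma ito_isometry_diff:
  assumes \<xi>: "elementary_integrand G t m \<tau> \<xi>" and \<eta>: "elementary_integrand G t l \<sigma> \<eta>"
    and t: "0 \<le> t" "t \<le> S"
  shows "(\<integral>\<^sup>+\<omega>. ennreal ((elementary_integral W m \<tau> \<xi> \<omega> - elementary_integral W l \<sigma> \<eta> \<omega>)\<^sup>2) \<partial>M)
    = (\<integral>\<^sup>+\<omega>. (\<integral>\<^sup>+s\<in>{0..t}. ennreal ((norm (elementary_process m \<tau> \<xi> s \<omega> - elementary_process l \<sigma> \<eta> s \<omega>))\<^sup>2)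
        \<partial>lborel) \<partial>M)"
proof -
  let ?J = "{..<m} <+> {..<l}"
  let ?a = "case_sum \<tau> \<sigma>" and ?b = "case_sum (\<lambda>i. \<tau> (Suc i)) (\<lambda>i. \<sigma> (Suc i))"
  let ?\<xi> = "case_sum \<xi> (\<lambda>i \<omega>. - \<eta> i \<omega>)"
  have "(\<integral>\<^sup>+\<omega>. ennreal ((\<Sum>i\<in>?J. ?\<xi> i \<omega> \<bullet> (W (?b i) \<omega> - W (?a i) \<omega>))\<^sup>2) \<partial>M)
    = (\<integral>\<^sup>+\<omega>. (\<integral>\<^sup>+s\<in>{0..t}. ennreal ((norm (\<Sum>i\<in>?J. indicat_real {?a i<..?b i} s *\<^sub>R ?\<xi> i \<omega>))\<^sup>2) \<partial>lborel) \<partial>M)"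
    by (rule ito_isometry_sum)
      (use elementary_integrandD[OF \<xi>] elementary_integrandD[OF \<eta>] t in \<open>auto intro!: bounded_at_minus\<close>)
  also have "(\<lambda>\<omega>. (\<Sum>i\<in>?J. ?\<xi> i \<omega> \<bullet> (W (?b i) \<omega> - W (?a i) \<omega>)))
      = (\<lambda>\<omega>. elementary_integral W m \<tau> \<xi> \<omega> - elementary_integral W l \<sigma> \<eta> \<omega>)"
    by (simp add: sum.Plus elementary_integral_def sum_negf)
  also have "(\<lambda>\<omega> s. \<Sum>i\<in>?J. indicat_real {?a i<..?b i} s *\<^sub>R ?\<xi> i \<omega>)
      = (\<lambda>\<omega> s. elementary_process m \<tau> \<xi> s \<omega> - elementary_process l \<sigma> \<eta> s \<omega>)"
    by (simp only: sum.Plus finite_lessThan elementary_process_def comp_def sum.case scaleR_minus_right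
        sum_negf diff_conv_add_uminus)
  finally show ?thesis .
qed

section \<open>Joint measurability and the passage to the limit\<close>

lemma elementary_integral_measurable:
  fixes \<xi> :: "nat \<Rightarrow> 'w \<Rightarrow> real ^ 'n"
  assumes "elementary_integrand G t m \<tau> \<xi>" "t \<le> S"
  shows "elementary_integral W m \<tau> \<xi> \<in> borel_measurable M"
  unfolding elementary_integral_def
proof (intro borel_measurable_sum borel_measurable_inner borel_measurable_diff)
  fix i assume "i \<in> {..<m}"
  with elementary_integrandD[OF assms(1), of i] assms(2)
  show "\<xi> i \<in> borel_measurable M" "W (\<tau> (Suc i)) \<in> borel_measurable M" "W (\<tau> i) \<in> borel_measurable M"
    by (auto intro!: W_measurable bounded_at_measurable)
qed

lemma elementary_process_measurable:
  fixes \<xi> :: "nat \<Rightarrow> 'w \<Rightarrow> real ^ 'n"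
  assumes "elementary_integrand G t m \<tau> \<xi>" "t \<le> S"
  shows "(\<lambda>(\<omega>, s). elementary_process m \<tau> \<xi> s \<omega>) \<in> borel_measurable (M \<Otimes>\<^sub>M restrict_space lborel {0..t})"
  unfolding elementary_process_def split_beta
proof (intro borel_measurable_sum borel_measurable_scaleR)
  fix i assume "i \<in> {..<m}"
  with elementary_integrandD[OF assms(1), of i] assms(2)
  have [measurable]: "\<xi> i \<in> borel_measurable M"
    by (auto intro!: bounded_at_measurable)
  show "(\<lambda>x. \<xi> i (fst x)) \<in> borel_measurable (M \<Otimes>\<^sub>M restrict_space lborel {0..t})"
    by measurable
  have [measurable]: "indicat_real {\<tau> i<..\<tau> (Suc i)} \<in> borel_measurable (restrict_space lborel {0..t})"
    by (intro measurable_restrict_space1) simp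
  show "(\<lambda>x. indicat_real {\<tau> i<..\<tau> (Suc i)} (snd x)) \<in> borel_measurable (M \<Otimes>\<^sub>M restrict_space lborel {0..t})"
    by (rule measurable_compose[OF measurable_snd]) measurable
qed

text \<open>Compose with the map that swaps the two coordinates; it is measurable because
  \<open>G t\<close> is coarser than \<open>M\<close>. The probability space comes first to match
  the order of the iterated integrals.\<close>

lemma progressive_measurable:
  fixes \<phi> :: "real \<Rightarrow> 'w \<Rightarrow> real ^ 'n"
  assumes "(\<lambda>(s, \<omega>). \<phi> s \<omega>) \<in> borel_measurable (restrict_space borel {0..t} \<Otimes>\<^sub>M G t)" "0 \<le> t" "t \<le> S"
  shows "(\<lambda>(\<omega>, s). \<phi> s \<omega>) \<in> borel_measurable (M \<Otimes>\<^sub>M restrict_space lborel {0..t})"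
proof -
  have "(\<lambda>\<omega>. \<omega>) \<in> measurable M (G t)"
    using sets_G[OF assms(2,3)] sets.sets_into_space by (fastforce simp: measurable_def Int_absorb2)
  then have [measurable]: "fst \<in> measurable (M \<Otimes>\<^sub>M restrict_space lborel {0..t}) (G t)"
    by (rule measurable_compose[OF measurable_fst])
  have "(\<lambda>s. s) \<in> measurable (restrict_space lborel {0..t}) (restrict_space borel {0..t})"
    by (simp add: measurable_cong_sets[OF sets_restrict_space_cong[OF sets_lborel] refl])
  then have [measurable]: "snd \<in> measurable (M \<Otimes>\<^sub>M restrict_space lborel {0..t}) (restrict_space borel {0..t})"
    by (rule measurable_compose[OF measurable_snd])
  have "(\<lambda>x. (snd x, fst x)) \<in> measurable (M \<Otimes>\<^sub>M restrict_space lborel {0..t}) (restrict_space borel {0..t} \<Otimes>\<^sub>M G t)"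
    by measurable
  from measurable_compose[OF this assms(1)] show ?thesis
    by (simp add: split_beta)
qed

text \<open>Compare both integrals with their elementary approximations, use the isometry there, and
  return from the approximations to \<open>\<phi>\<close> and \<open>\<psi>\<close>. Each of the two
  comparisons costs a factor \<open>3\<close>, and the errors vanish in the limit.\<close>

lemma has_ito_integral_diff_le:
  assumes \<phi>: "has_ito_integral M G W t \<phi> X" and \<psi>: "has_ito_integral M G W t \<psi> Y"
    and t: "0 \<le> t" "t \<le> S"
  shows "(\<integral>\<^sup>+\<omega>. ennreal ((X \<omega> - Y \<omega>)\<^sup>2) \<partial>M)
    \<le> 9 * (\<integral>\<^sup>+\<omega>. (\<integral>\<^sup>+s\<in>{0..t}. ennreal ((norm (\<phi> s \<omega> - \<psi> s \<omega>))\<^sup>2) \<partial>lborel) \<partial>M)"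
proof -
  define R :: "real measure" where "R = restrict_space lborel {0..t}"
  interpret R: sigma_finite_measure R
    unfolding R_def by (intro sigma_finite_measure_restrict_space lborel.sigma_finite_measure_axioms) auto
  \<comment> \<open>By Tonelli the iterated integral is one integral over a product measure, to
    which the three-term inequality applies directly.\<close>
  have iter: "(\<integral>\<^sup>+\<omega>. (\<integral>\<^sup>+s\<in>{0..t}. ennreal ((norm (u s \<omega> - v s \<omega>))\<^sup>2) \<partial>lborel) \<partial>M)
      = (\<integral>\<^sup>+(\<omega>, s). ennreal ((norm (u s \<omega> - v s \<omega>))\<^sup>2) \<partial>(M \<Otimes>\<^sub>M R))"
    if [measurable]: "(\<lambda>(\<omega>, s). u s \<omega>) \<in> borel_measurable (M \<Otimes>\<^sub>M R)"
      "(\<lambda>(\<omega>, s). v s \<omega>) \<in> borel_measurable (M \<Otimes>\<^sub>M R)"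
    for u v :: "real \<Rightarrow> 'w \<Rightarrow> real ^ 'n"
  proof -
    have [measurable]: "(\<lambda>(\<omega>, s). ennreal ((norm (u s \<omega> - v s \<omega>))\<^sup>2)) \<in> borel_measurable (M \<Otimes>\<^sub>M R)"
      using that by (simp add: split_beta')
    have "(\<integral>\<^sup>+\<omega>. (\<integral>\<^sup>+s\<in>{0..t}. ennreal ((norm (u s \<omega> - v s \<omega>))\<^sup>2) \<partial>lborel) \<partial>M)
        = (\<integral>\<^sup>+\<omega>. (\<integral>\<^sup>+s. ennreal ((norm (u s \<omega> - v s \<omega>))\<^sup>2) \<partial>R) \<partial>M)"
      by (simp add: R_def nn_integral_restrict_space)
    then show ?thesis
      by (simp add: R.nn_integral_fst[symmetric])
  qed
  from \<phi> obtain m \<tau> \<xi> where \<xi>: "\<And>k::nat. elementary_integrand G t (m k) (\<tau> k) (\<xi> k)"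
    "(\<lambda>k. \<integral>\<^sup>+\<omega>. (\<integral>\<^sup>+s\<in>{0..t}.
        ennreal ((norm (\<phi> s \<omega> - elementary_process (m k) (\<tau> k) (\<xi> k) s \<omega>))\<^sup>2) \<partial>lborel) \<partial>M) \<longlonglongrightarrow> 0"
    "(\<lambda>k. \<integral>\<^sup>+\<omega>. ennreal ((X \<omega> - elementary_integral W (m k) (\<tau> k) (\<xi> k) \<omega>)\<^sup>2) \<partial>M) \<longlonglongrightarrow> 0"
    unfolding has_ito_integral_def by blast
  from \<psi> obtain l \<sigma> \<eta> where \<eta>: "\<And>k::nat. elementary_integrand G t (l k) (\<sigma> k) (\<eta> k)"
    "(\<lambda>k. \<integral>\<^sup>+\<omega>. (\<integral>\<^sup>+s\<in>{0..t}.
        ennreal ((norm (\<psi> s \<omega> - elementary_process (l k) (\<sigma> k) (\<eta> k) s \<omega>))\<^sup>2) \<partial>lborel) \<partial>M) \<longlonglongrightarrow> 0"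
    "(\<lambda>k. \<integral>\<^sup>+\<omega>. ennreal ((Y \<omega> - elementary_integral W (l k) (\<sigma> k) (\<eta> k) \<omega>)\<^sup>2) \<partial>M) \<longlonglongrightarrow> 0"
    unfolding has_ito_integral_def by blast
  define e where "e k = elementary_process (m k) (\<tau> k) (\<xi> k)" for k
  define e' where "e' k = elementary_process (l k) (\<sigma> k) (\<eta> k)" for k
  define I where "I k = elementary_integral W (m k) (\<tau> k) (\<xi> k)" for k
  define I' where "I' k = elementary_integral W (l k) (\<sigma> k) (\<eta> k)" for k
  define D where "D u v = (\<integral>\<^sup>+(\<omega>, s). ennreal ((norm (u s \<omega> - v s \<omega>))\<^sup>2) \<partial>(M \<Otimes>\<^sub>M R))"
    for u v :: "real \<Rightarrow> 'w \<Rightarrow> real ^ 'n"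
  define E where "E u v = (\<integral>\<^sup>+\<omega>. ennreal ((u \<omega> - v \<omega>)\<^sup>2) \<partial>M)" for u v :: "'w \<Rightarrow> real"
  have meas [measurable]: "X \<in> borel_measurable M" "Y \<in> borel_measurable M"
    "(\<lambda>(\<omega>, s). \<phi> s \<omega>) \<in> borel_measurable (M \<Otimes>\<^sub>M R)"
    "(\<lambda>(\<omega>, s). \<psi> s \<omega>) \<in> borel_measurable (M \<Otimes>\<^sub>M R)"
  proof -
    show "X \<in> borel_measurable M" "Y \<in> borel_measurable M"
      using \<phi> \<psi> unfolding has_ito_integral_def by blast+
    have "t \<in> {0..t}" using t by simp
    then show "(\<lambda>(\<omega>, s). \<phi> s \<omega>) \<in> borel_measurable (M \<Otimes>\<^sub>M R)"
        "(\<lambda>(\<omega>, s). \<psi> s \<omega>) \<in> borel_measurable (M \<Otimes>\<^sub>M R)"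
      using \<phi> \<psi> t unfolding has_ito_integral_def R_def by (blast intro: progressive_measurable)+
  qed
  have e_meas [measurable]: "(\<lambda>(\<omega>, s). e k s \<omega>) \<in> borel_measurable (M \<Otimes>\<^sub>M R)"
    "(\<lambda>(\<omega>, s). e' k s \<omega>) \<in> borel_measurable (M \<Otimes>\<^sub>M R)"
    "I k \<in> borel_measurable M" "I' k \<in> borel_measurable M" for k
    unfolding e_def e'_def I_def I'_def R_def
    using elementary_process_measurable[OF \<xi>(1) t(2)] elementary_process_measurable[OF \<eta>(1) t(2)]
      elementary_integral_measurable[OF \<xi>(1) t(2)] elementary_integral_measurable[OF \<eta>(1) t(2)]
    by auto
  have bound: "E X Y \<le> 3 * (E X (I k) + 3 * (D \<phi> (e k) + D \<phi> \<psi> + D \<psi> (e' k)) + E Y (I' k))" for k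
  proof -
    \<comment> \<open>The chain is \<open>X\<close>, \<open>I k\<close>, \<open>I' k\<close>,
      \<open>Y\<close>. The middle distance becomes a distance of elementary processes by the
      isometry and is then bounded through the chain \<open>e k\<close>, \<open>\<phi>\<close>,
      \<open>\<psi>\<close>, \<open>e' k\<close>.\<close>
    have "E X Y \<le> 3 * (E X (I k) + E (I k) (I' k) + E Y (I' k))"
      using nn_integral_norm_add3_square_le[of "\<lambda>\<omega>. X \<omega> - I k \<omega>" M "\<lambda>\<omega>. I k \<omega> - I' k \<omega>" "\<lambda>\<omega>. I' k \<omega> - Y \<omega>"]
      by (simp add: E_def power2_commute[of "Y _"])
    also have "E (I k) (I' k) = D (e k) (e' k)"
      unfolding E_def I_def I'_def D_def ito_isometry_diff[OF \<xi>(1) \<eta>(1) t] iter[OF e_meas(1,2), symmetric]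
      by (simp add: e_def e'_def)
    also have "D (e k) (e' k) \<le> 3 * (D \<phi> (e k) + D \<phi> \<psi> + D \<psi> (e' k))"
      using nn_integral_norm_add3_square_le[of "\<lambda>(\<omega>, s). e k s \<omega> - \<phi> s \<omega>" "M \<Otimes>\<^sub>M R"
          "\<lambda>(\<omega>, s). \<phi> s \<omega> - \<psi> s \<omega>" "\<lambda>(\<omega>, s). \<psi> s \<omega> - e' k s \<omega>"]
      by (simp add: D_def split_beta' norm_minus_commute[of "\<phi> _ _" "e k _ _"])
    finally show ?thesis
      by (simp add: mult_left_mono add_mono)
  qed
  have "(\<lambda>k. D \<phi> (e k)) \<longlonglongrightarrow> 0" "(\<lambda>k. D \<psi> (e' k)) \<longlonglongrightarrow> 0"
    "(\<lambda>k. E X (I k)) \<longlonglongrightarrow> 0" "(\<lambda>k. E Y (I' k)) \<longlonglongrightarrow> 0"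
    using \<xi>(2,3) \<eta>(2,3)
    by (simp_all add: D_def E_def I_def I'_def iter[OF meas(3) e_meas(1), symmetric]
        iter[OF meas(4) e_meas(2), symmetric]) (simp_all add: e_def e'_def)
  \<comment> \<open>The limit is taken in \<open>ennreal\<close>, where addition stays continuous
    even if \<open>D \<phi> \<psi>\<close> is infinite.\<close>
  then have "(\<lambda>k. 3 * (E X (I k) + 3 * (D \<phi> (e k) + D \<phi> \<psi> + D \<psi> (e' k)) + E Y (I' k)))
      \<longlonglongrightarrow> 3 * (0 + 3 * (0 + D \<phi> \<psi> + 0) + 0)"
    by (intro ennreal_tendsto_cmult tendsto_add tendsto_const) auto
  then have "E X Y \<le> 3 * (0 + 3 * (0 + D \<phi> \<psi> + 0) + 0)"
    by (rule LIMSEQ_le_const) (use bound in auto)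
  then show ?thesis
    by (simp add: E_def D_def iter[OF meas(3,4)] mult.assoc[symmetric])
qed

end

section \<open>Variance bound and averages of Hoelder functions\<close>

text \<open>Variance ignores the shift by \<open>c\<close> and is at most the second moment of the
  shifted variable. Stating the bound with a nonnegative integral makes integrability of
  \<open>Z\<close> part of the argument.\<close>

lemma (in prob_space) variance_le_second_moment:
  fixes Z :: "'a \<Rightarrow> real"
  assumes [measurable]: "Z \<in> borel_measurable M"
    and B: "(\<integral>\<^sup>+\<omega>. ennreal ((Z \<omega> - c)\<^sup>2) \<partial>M) \<le> ennreal B" "0 \<le> B"
  shows "variance Z \<le> B"
proof -
  define D where "D \<omega> = Z \<omega> - c" for \<omega>
  have [measurable]: "D \<in> borel_measurable M" unfolding D_def by measurable
  have sq: "integrable M (\<lambda>\<omega>. (D \<omega>)\<^sup>2)"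
    using B(1) by (intro integrableI_bounded) (auto simp: D_def intro: le_less_trans)
  then have D: "integrable M D"
    by (rule square_integrable_imp_integrable[rotated]) measurable
  then have "integrable M (\<lambda>\<omega>. D \<omega> + c)" by simp
  then have Z: "integrable M Z" by (simp add: D_def)
  have "expectation D = expectation Z - c"
    using Z by (simp add: D_def[abs_def] prob_space)
  then have "variance Z = variance D"
    by (simp add: D_def)
  also have "\<dots> \<le> expectation (\<lambda>\<omega>. (D \<omega>)\<^sup>2)"
    by (simp add: variance_eq[OF D sq])
  also have "\<dots> \<le> B"
    using B nn_integral_eq_integral[OF sq] by (simp add: D_def)
  finally show ?thesis .
qed

text \<open>Continuity guarantees that the average of the kernel over a delivery period is a genuine
  integral.\<close>

lemma hoelder_imp_continuous_on:
  fixes k :: "real \<Rightarrow> 'a :: real_normed_vector"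
  assumes "0 < \<rho>" "\<And>T T'. T \<in> A \<Longrightarrow> T' \<in> A \<Longrightarrow> norm (k T - k T') \<le> C * \<bar>T - T'\<bar> powr \<rho>"
  shows "continuous_on A k"
  unfolding continuous_on_def
proof
  fix T assume T: "T \<in> A"
  have "((\<lambda>T'. \<bar>T' - T\<bar>) \<longlongrightarrow> 0) (at T within A)"
    by (intro tendsto_rabs_zero LIM_zero tendsto_ident_at)
  then have "((\<lambda>T'. \<bar>T' - T\<bar> powr \<rho>) \<longlongrightarrow> 0) (at T within A)"
    using assms(1) by (intro tendsto_zero_powrI[where b = \<rho>]) auto
  then have "((\<lambda>T'. C * \<bar>T' - T\<bar> powr \<rho>) \<longlongrightarrow> 0) (at T within A)"
    by (rule tendsto_mult_right_zero)
  then have "((\<lambda>T'. k T' - k T) \<longlongrightarrow> 0) (at T within A)"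
    by (rule Lim_null_comparison[rotated]) (use assms(2) T in \<open>auto simp: eventually_at_filter\<close>)
  then show "(k \<longlongrightarrow> k T) (at T within A)"
    by (rule LIM_zero_cancel)
qed

text \<open>The left-hand side is the norm of the average of \<open>k x - k T\<close> over
  \<open>T\<close>, and no \<open>T\<close> in the interval is farther from \<open>x\<close> than
  \<open>b - a\<close>.\<close>

lemma hoelder_diff_average_le:
  fixes k :: "real \<Rightarrow> 'a :: euclidean_space"
  assumes \<rho>: "0 < \<rho>" and C: "0 \<le> C" and ab: "a < b" "x \<in> {a..b}"
    and k: "\<And>T T'. T \<in> {a..b} \<Longrightarrow> T' \<in> {a..b} \<Longrightarrow> norm (k T - k T') \<le> C * \<bar>T - T'\<bar> powr \<rho>"
  shows "norm (k x - (1 / (b - a)) *\<^sub>R (LBINT T:{a..b}. k T)) \<le> C * (b - a) powr \<rho>"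
proof -
  have cont: "continuous_on {a..b} k"
    by (rule hoelder_imp_continuous_on[OF \<rho> k])
  have "norm (integral {a..b} (\<lambda>T. k x - k T)) \<le> C * (b - a) powr \<rho> * (b - a)"
  proof (rule integral_bound)
    show "continuous_on {a..b} (\<lambda>T. k x - k T)"
      using cont by (intro continuous_intros)
    fix T assume T: "T \<in> {a..b}"
    have "norm (k x - k T) \<le> C * \<bar>x - T\<bar> powr \<rho>"
      using k ab(2) T by blast
    also have "\<dots> \<le> C * (b - a) powr \<rho>"
      using T ab \<rho> C by (intro mult_left_mono powr_mono2) auto
    finally show "norm (k x - k T) \<le> C * (b - a) powr \<rho>" .
  qed (use ab in simp)
  moreover have "integral {a..b} (\<lambda>T. k x - k T) = (b - a) *\<^sub>R k x - integral {a..b} k"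
    using ab by (simp add: integral_diff integrable_continuous_interval cont)
  moreover have "(LBINT T:{a..b}. k T) = integral {a..b} k"
    by (intro set_borel_integral_eq_integral borel_integrable_atLeastAtMost' cont)
  moreover have "k x - (1 / (b - a)) *\<^sub>R integral {a..b} k
      = (1 / (b - a)) *\<^sub>R ((b - a) *\<^sub>R k x - integral {a..b} k)"
    using ab by (simp add: scaleR_diff_right)
  ultimately show ?thesis
    using ab by (simp add: pos_divide_le_eq)
qed

section \<open>Variance of the difference between instantaneous and averaged forward\<close>

theorem lemma10:
  fixes Q :: "'w measure" and G :: "real \<Rightarrow> 'w measure"
    and W :: "real \<Rightarrow> 'w \<Rightarrow> real ^ 'n"
    and K :: "real \<Rightarrow> real \<Rightarrow> real ^ 'n"
    and F :: "real \<Rightarrow> real \<Rightarrow> 'w \<Rightarrow> real" and F0 :: "real \<Rightarrow> real"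
    and Tbar \<rho> :: real
  assumes bm: "brownian_motion Q G Tbar W"
    and K_meas: "\<And>T. T \<in> {0..Tbar} \<Longrightarrow> set_borel_measurable lborel {0..T} (K T)"
    and K_L2: "\<And>T. T \<in> {0..Tbar} \<Longrightarrow> set_integrable lborel {0..T} (\<lambda>s. (norm (K T s))\<^sup>2)"
    and F_init: "\<And>T \<omega>. T \<in> {0..Tbar} \<Longrightarrow> \<omega> \<in> space Q \<Longrightarrow> F 0 T \<omega> = F0 T"
    and rho: "0 < \<rho>" "\<rho> \<le> 1"
    and holder: "\<exists>C. \<forall>T\<in>{0..Tbar}. \<forall>T'\<in>{0..Tbar}. \<forall>s\<in>{0..Tbar}.
                   norm (K T s - K T' s) \<le> C * \<bar>T - T'\<bar> powr \<rho>"
  shows "\<exists>M. \<forall>t Tj Tk Tt.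
           0 \<le> t \<and> t \<le> Tj \<and> Tj < Tk \<and> Tk \<le> Tbar \<and> Tt \<in> {Tj..Tk} \<and>
           has_dynamics Q G W Tt (\<lambda>u. F u Tt) (\<lambda>u \<omega>. K Tt u) \<and>
           has_dynamics Q G W Tj (avg_forward F Tj Tk) (\<lambda>u \<omega>. avg_kernel K Tj Tk u) \<longrightarrow>
           prob_space.variance Q (\<lambda>\<omega>. F t Tt \<omega> - avg_forward F Tj Tk t \<omega>)
             \<le> M * (Tk - Tj) powr (2 * \<rho>)"
proof -
  interpret brownian Q G Tbar W
    using bm by unfold_locales
  obtain C0 where C0: "\<And>T T' s. T \<in> {0..Tbar} \<Longrightarrow> T' \<in> {0..Tbar} \<Longrightarrow> s \<in> {0..Tbar} \<Longrightarrow>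
      norm (K T s - K T' s) \<le> C0 * \<bar>T - T'\<bar> powr \<rho>"
    using holder by blast
  \<comment> \<open>The sign of \<open>C0\<close> is not prescribed, and enlarging the distance in
    the Hoelder bound requires a nonnegative factor.\<close>
  define C where "C = \<bar>C0\<bar>"
  have "0 \<le> C" by (simp add: C_def)
  have C: "norm (K T s - K T' s) \<le> C * \<bar>T - T'\<bar> powr \<rho>"
    if "T \<in> {0..Tbar}" "T' \<in> {0..Tbar}" "s \<in> {0..Tbar}" for T T' s
    using C0[OF that] unfolding C_def by (rule order_trans) (simp add: mult_right_mono)
  \<comment> \<open>The factor \<open>9\<close> comes from \<open>has_ito_integral_diff_le\<close>,
    \<open>C\<^sup>2\<close> from squaring the Hoelder bound, and \<open>Tbar\<close> bounds the
    length \<open>t\<close> of the time interval.\<close>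
  have "variance (\<lambda>\<omega>. F t Tt \<omega> - avg_forward F Tj Tk t \<omega>) \<le> 9 * C\<^sup>2 * Tbar * (Tk - Tj) powr (2 * \<rho>)"
    if T: "0 \<le> t" "t \<le> Tj" "Tj < Tk" "Tk \<le> Tbar" "Tt \<in> {Tj..Tk}"
      and dF: "has_dynamics Q G W Tt (\<lambda>u. F u Tt) (\<lambda>u \<omega>. K Tt u)"
      and dA: "has_dynamics Q G W Tj (avg_forward F Tj Tk) (\<lambda>u \<omega>. avg_kernel K Tj Tk u)"
    for t Tj Tk Tt
  proof (rule variance_le_second_moment)
    define X where "X \<omega> = F t Tt \<omega> - F 0 Tt \<omega>" for \<omega>
    define Y where "Y \<omega> = avg_forward F Tj Tk t \<omega> - avg_forward F Tj Tk 0 \<omega>" for \<omega>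
    \<comment> \<open>The difference of the initial values, deterministic by \<open>F_init\<close>,
      is the constant by which the variable is shifted.\<close>
    define c where "c = F0 Tt - 1 / (Tk - Tj) * (LBINT T:{Tj..Tk}. F0 T)"
    \<comment> \<open>Both dynamics reach time \<open>t\<close>, since
      \<open>t \<le> Tj \<le> Tt\<close>.\<close>
    have X: "has_ito_integral Q G W t (\<lambda>u \<omega>. K Tt u) X"
      using dF T by (auto simp: has_dynamics_def X_def[abs_def])
    have Y: "has_ito_integral Q G W t (\<lambda>u \<omega>. avg_kernel K Tj Tk u) Y"
      using dA T by (auto simp: has_dynamics_def Y_def[abs_def])
    have [measurable]: "X \<in> borel_measurable Q" "Y \<in> borel_measurable Q"
      using X Y unfolding has_ito_integral_def by blast+
    have XY: "F t Tt \<omega> - avg_forward F Tj Tk t \<omega> = X \<omega> - Y \<omega> + c" if "\<omega> \<in> space Q" for \<omega>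
    proof -
      have "avg_forward F Tj Tk 0 \<omega> = 1 / (Tk - Tj) * (LBINT T:{Tj..Tk}. F0 T)"
        unfolding avg_forward_def using T that
        by (intro arg_cong2[where f = "(*)"] refl set_lebesgue_integral_cong) (auto intro!: F_init)
      then show ?thesis
        using T that F_init[of Tt \<omega>] by (simp add: X_def Y_def c_def)
    qed
    show "(\<lambda>\<omega>. F t Tt \<omega> - avg_forward F Tj Tk t \<omega>) \<in> borel_measurable Q"
      by (subst measurable_cong[OF XY]) measurable
    define L where "L = C * (Tk - Tj) powr \<rho>"
    have L2: "L\<^sup>2 = C\<^sup>2 * (Tk - Tj) powr (2 * \<rho>)"
      using T by (simp add: L_def power_mult_distrib powr_powr[symmetric] powr_numeral mult.commute[of 2])
    \<comment> \<open>For fixed \<open>s\<close> the Hoelder estimate is applied to the map taking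
      \<open>T\<close> to \<open>K T s\<close> on the delivery period;
      \<open>s \<le> t \<le> Tbar\<close> keeps \<open>s\<close> in the range of the
      hypothesis.\<close>
    have kernel: "norm (K Tt s - avg_kernel K Tj Tk s) \<le> L" if "s \<in> {0..t}" for s
      unfolding avg_kernel_def L_def
      by (rule hoelder_diff_average_le) (use rho T that \<open>0 \<le> C\<close> in \<open>auto intro!: C\<close>)
    have "(\<integral>\<^sup>+\<omega>. ennreal ((F t Tt \<omega> - avg_forward F Tj Tk t \<omega> - c)\<^sup>2) \<partial>Q)
        = (\<integral>\<^sup>+\<omega>. ennreal ((X \<omega> - Y \<omega>)\<^sup>2) \<partial>Q)"
      by (intro nn_integral_cong) (simp add: XY)
    also have "\<dots> \<le> 9 * (\<integral>\<^sup>+\<omega>. (\<integral>\<^sup>+s\<in>{0..t}. ennreal ((norm (K Tt s - avg_kernel K Tj Tk s))\<^sup>2) \<partial>lborel) \<partial>Q)"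
      using T by (intro has_ito_integral_diff_le[OF X Y]) auto
    also have "\<dots> \<le> 9 * (\<integral>\<^sup>+\<omega>. (\<integral>\<^sup>+s\<in>{0..t}. ennreal (L\<^sup>2) \<partial>lborel) \<partial>Q)"
      using kernel
      by (intro mult_left_mono nn_integral_mono) (auto simp: indicator_def intro!: ennreal_leI power_mono)
    also have "\<dots> = ennreal (9 * (L\<^sup>2 * t))"
      using T by (simp add: nn_integral_cmult_indicator emeasure_space_1 ennreal_mult flip: ennreal_numeral)
    also have "\<dots> \<le> ennreal (9 * C\<^sup>2 * Tbar * (Tk - Tj) powr (2 * \<rho>))"
    proof (rule ennreal_leI)
      have "L\<^sup>2 * t \<le> L\<^sup>2 * Tbar"
        using T by (intro mult_left_mono) auto
      then show "9 * (L\<^sup>2 * t) \<le> 9 * C\<^sup>2 * Tbar * (Tk - Tj) powr (2 * \<rho>)"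
        by (simp add: L2 mult_ac)
    qed
    finally show "(\<integral>\<^sup>+\<omega>. ennreal ((F t Tt \<omega> - avg_forward F Tj Tk t \<omega> - c)\<^sup>2) \<partial>Q)
        \<le> ennreal (9 * C\<^sup>2 * Tbar * (Tk - Tj) powr (2 * \<rho>))" .
    show "0 \<le> 9 * C\<^sup>2 * Tbar * (Tk - Tj) powr (2 * \<rho>)"
      using T by simp
  qed
  then show ?thesis
    by blast
qed

end
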